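(* Let $(\varphi(n))_{n\ge1}$ be any strictly increasing sequence of real numbers with $\varphi(n) \geq 2n$ for all $n \in \mathbb{N}$. Then for all irrational $\alpha$ with bounded continued fraction coefficients there is a constant $L$ and a strictly increasing sequence of integers $(a_n)_{n\ge1}$, with $\varphi(n) \leq a_n \leq L\varphi(n)$ for all $n \geq 1$, such that $(\{a_n\alpha\})_{n\ge1}$ is uniformly distributed modulo 1 and such that $(\{a_n\alpha\})_{n\ge1}$ has a dense collection of BRS.
   Context: $\mathbb{N}=\{1,2,\dots\}$; $\{x\}$ denotes the fractional part of $x$. A sequence $(x_n)_{n\ge1}$ in $[0,1)$ is uniformly distributed modulo 1 if $\lim_{N\to\infty}\frac1N\#\{1\le n\le N:x_n\in[a,b)\}=b-a$ for every interval $[a,b)\subseteq[0,1)$. Bounded remainder set (BRS): for a sequence $(x_n)_{n\ge 1}$ in $[0,1)$ and $[a,b)\subseteq[0,1)$ put $D_N([a,b)) = \frac1N\left(\#\{1\le n\le N: x_n\in[a,b)\} - N(b-a)\right)$. The interval $[a,b)$ is a BRS for $(x_n)_{n\geq 1}$ if there is a constant $c$ (independent of $N$) such that $|D_N([a,b))|\le c\,\frac1N$ for all $N\in\mathbb{N}$. The sequence $(x_n)_{n\ge1}$ has a dense collection of BRS if for all $\varepsilon>0$ and all $x,y\in[0,1)$ with $x<y$ there is a BRS $[a,b)$ for the sequence with $|a-x|<\varepsilon$ and $|b-y|<\varepsilon$. *)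

theory Defs
  imports Complex_Main
begin

text \<open>
  Sequences \<open>(x\<^sub>n)\<close> with \<open>n \<ge> 1\<close> are functions on \<^typ>\<open>nat\<close> whose value at \<open>0\<close> is
  never used.
\<close>

definition count_in :: "(nat \<Rightarrow> real) \<Rightarrow> nat \<Rightarrow> real set \<Rightarrow> nat" where
  "count_in x N I = card {n \<in> {1..N}. x n \<in> I}"

definition uniformly_distributed_mod1 :: "(nat \<Rightarrow> real) \<Rightarrow> bool" where
  "uniformly_distributed_mod1 x \<longleftrightarrow>
     (\<forall>a b. 0 \<le> a \<and> a < b \<and> b \<le> 1 \<longrightarrow>
        (\<lambda>N. real (count_in x N {a..<b}) / real N) \<longlonglongrightarrow> b - a)"

definition discrepancy :: "(nat \<Rightarrow> real) \<Rightarrow> nat \<Rightarrow> real \<Rightarrow> real \<Rightarrow> real" where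
  "discrepancy x N a b = 1 / real N * (real (count_in x N {a..<b}) - real N * (b - a))"

definition bounded_remainder_set :: "(nat \<Rightarrow> real) \<Rightarrow> real \<Rightarrow> real \<Rightarrow> bool" where
  "bounded_remainder_set x a b \<longleftrightarrow>
     0 \<le> a \<and> a < b \<and> b \<le> 1 \<and>
     (\<exists>c. \<forall>N\<ge>1. \<bar>discrepancy x N a b\<bar> \<le> c * (1 / real N))"

definition dense_BRS :: "(nat \<Rightarrow> real) \<Rightarrow> bool" where
  "dense_BRS z \<longleftrightarrow>
     (\<forall>\<epsilon>>0. \<forall>x\<in>{0..<1}. \<forall>y\<in>{0..<1}. x < y \<longrightarrow>
        (\<exists>a b. bounded_remainder_set z a b \<and> \<bar>a - x\<bar> < \<epsilon> \<and> \<bar>b - y\<bar> < \<epsilon>))"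

text \<open>
  The regular continued fraction expansion \<open>\<alpha> = [a\<^sub>0; a\<^sub>1, a\<^sub>2, \<dots>]\<close>, read off from the complete
  quotients. It is meant for irrational \<open>\<alpha>\<close>, where \<^term>\<open>frac\<close> never vanishes along the
  recursion and \<open>a\<^sub>k \<ge> 1\<close> for \<open>k \<ge> 1\<close>, so that an upper bound on these coefficients is enough.
\<close>

fun complete_quotient :: "real \<Rightarrow> nat \<Rightarrow> real" where
  "complete_quotient \<alpha> 0 = \<alpha>"
| "complete_quotient \<alpha> (Suc k) = 1 / frac (complete_quotient \<alpha> k)"

definition cf_coeff :: "real \<Rightarrow> nat \<Rightarrow> int" where
  "cf_coeff \<alpha> k = \<lfloor>complete_quotient \<alpha> k\<rfloor>"

definition bounded_cf_coeffs :: "real \<Rightarrow> bool" where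
  "bounded_cf_coeffs \<alpha> \<longleftrightarrow> (\<exists>M. \<forall>k\<ge>1. cf_coeff \<alpha> k \<le> M)"

end

theory Submission
  imports Defs "HOL-Analysis.Kronecker_Approximation_Theorem"
begin

text \<open>
  The sequence is a perturbed Kronecker sequence \<open>a\<^sub>n = n + m\<^sub>n\<close>: the point \<open>{n\<alpha>}\<close> is shifted by
  \<open>s\<^sub>n = m\<^sub>n\<alpha> - p\<^sub>n\<close>, the signed distance of \<open>m\<^sub>n\<alpha>\<close> to a nearby integer. So the task is to choose
  \<open>m\<^sub>n\<close> nondecreasing and of the order of \<open>\<phi>(n)\<close>, with a shift so small that it does not disturb
  the bounded remainder sets of \<open>{n\<alpha>}\<close>.

  For \<open>{n\<alpha>}\<close> itself, an interval \<open>[{i\<alpha>}, {j\<alpha>})\<close> is a bounded remainder set, because its centred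
  indicator at \<open>{t}\<close> is \<open>{t - j\<alpha>} - {t - i\<alpha>}\<close> (lemma \<open>indicator_eq_frac_diff\<close>), which telescopes
  along the orbit. By Kronecker's theorem these intervals are dense. The same formula shows when a
  shift by \<open>s\<close> leaves the indicator unchanged at \<open>{n\<alpha>}\<close>: it is enough that \<open>\<bar>s\<bar>\<close> is smaller than
  the distances of \<open>(n - i)\<alpha>\<close> and \<open>(n - j)\<alpha>\<close> to the nearest integer, since then both fractional
  parts move by exactly \<open>s\<close>. If that holds for all but finitely many \<open>n\<close>, the remainder stays
  bounded (lemma \<open>perturbed_rotation_BRS\<close>).

  Boundedness of the continued fraction coefficients enters through a constant \<open>c > 0\<close> such that
  the distance of \<open>m\<alpha>\<close> to the nearest integer is at least \<open>c / m\<close> for all \<open>m \<ge> 1\<close> (lemma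
  \<open>badly_approximable\<close>). Let \<open>m\<^sub>n\<close> be the least \<open>m \<ge> \<phi>(n)\<close> for which \<open>m\<alpha>\<close> lies within
  \<open>c / \<phi>(n)\<close> of an integer. Dirichlet's theorem provides some \<open>m \<le> \<phi>(n)/c + 1\<close> at this distance,
  and bad approximability forces this \<open>m\<close> above \<open>\<phi>(n)\<close>; hence \<open>m\<^sub>n\<close> exists and is at most a
  constant times \<open>\<phi>(n)\<close>. As \<open>\<phi>\<close> grows both requirements become stricter, so \<open>m\<^sub>n\<close> is
  nondecreasing and \<open>a\<^sub>n\<close> strictly increasing. Finally, \<open>\<phi>(n) \<ge> 2n\<close> gives, for fixed \<open>i\<close> and
  \<open>n > i\<close>, that \<open>\<bar>s\<^sub>n\<bar> < c / \<phi>(n) \<le> c / (n - i)\<close>, which bounds the distance of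
  \<open>(n - i)\<alpha>\<close> to the nearest integer from below. This is the condition on the shift.

  Uniform distribution is then automatic: a dense collection of bounded remainder sets bounds the
  frequencies of all intervals from below, and passing to complements bounds them from above.
\<close>

section \<open>Bounded coefficients imply bad approximability\<close>

text \<open>
  One Gauss-map step turns the form \<open>m x\<^sub>k - p\<close> into \<open>q x\<^sub>k\<^sub>+\<^sub>1 - m\<close> with \<open>q = p - m \<lfloor>x\<^sub>k\<rfloor>\<close>, whose
  leading coefficient is smaller unless the form is already bounded away from \<open>0\<close>. If \<open>e\<close> and \<open>e'\<close>
  are the absolute values before and after, then \<open>e = f e'\<close> with \<open>f = {x\<^sub>k}\<close>, and the products
  \<open>m e\<close> and \<open>q e'\<close> agree up to \<open>f e'\<^sup>2\<close>. These errors would accumulate in an induction on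
  \<open>m e \<ge> c\<close>. The correction term \<open>e\<^sup>2 / \<delta>\<close> absorbs them: since \<open>f (f + \<delta>) \<le> 1\<close>, the quantity
  \<open>m e - e\<^sup>2 / \<delta>\<close> is at least \<open>q e' - e'\<^sup>2 / \<delta>\<close>. As it is useful only for small \<open>e\<close>, large values
  of \<open>e\<close> form a separate alternative.
\<close>

lemma linear_form_descent:
  fixes x :: "nat \<Rightarrow> real" and m :: nat and p :: int
  assumes \<delta>: "0 < \<delta>" and lo: "\<And>k. \<delta> \<le> frac (x k)" and hi: "\<And>k. frac (x k) \<le> 1 - \<delta>"
    and step: "\<And>k. x (Suc k) = 1 / frac (x k)"
    and "m > 0"
  defines "e \<equiv> \<lambda>(m::nat) (p::int) k. \<bar>real m * x k - p\<bar>"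
  shows "\<delta>\<^sup>2 / 2 \<le> e m p k \<or> \<delta> ^ 3 / 4 \<le> real m * e m p k - (e m p k)\<^sup>2 / \<delta>"
  using \<open>m > 0\<close>
proof (induction m arbitrary: p k rule: less_induct)
  case (less m)
  define f where "f = frac (x k)"
  define q where "q = p - int m * \<lfloor>x k\<rfloor>"
  define E where "E = e m p k"
  have f: "\<delta> \<le> f" "f \<le> 1 - \<delta>" using lo hi by (auto simp: f_def)
  have \<delta>1: "\<delta> \<le> 1 / 2" using f by linarith
  have E: "E = \<bar>real m * f - q\<bar>"
    by (simp add: E_def e_def f_def q_def frac_def algebra_simps)
  have \<eta>: "\<delta>\<^sup>2 / 2 \<le> \<delta>"
    using \<delta> \<delta>1 by (simp add: power2_eq_square mult_le_cancel_left)
  have m1: "real m \<ge> 1" using less.prems by simp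
  consider "q \<le> 0" | "q \<ge> int m" | "0 < q" "q < int m" by linarith
  then have "\<delta>\<^sup>2 / 2 \<le> E \<or> \<delta> ^ 3 / 4 \<le> real m * E - E\<^sup>2 / \<delta>"
  proof cases
    case 1
    have "f \<le> real m * f" using m1 f \<delta> by simp
    moreover have "real_of_int q \<le> 0" using 1 by simp
    ultimately have "\<delta> \<le> E" using f E by linarith
    then show ?thesis using \<eta> by linarith
  next
    case 2
    have "1 - f \<le> real m * (1 - f)" using m1 f \<delta> by simp
    moreover have "real_of_int q \<ge> real m" using 2 by linarith
    ultimately have "\<delta> \<le> E" using f E by (simp add: algebra_simps)
    then show ?thesis using \<eta> by linarith
  next
    case 3
    define E' where "E' = e (nat q) (int m) (Suc k)"
    have "E' = \<bar>(real_of_int q - real m * f) / f\<bar>"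
      using 3 f \<delta> unfolding E'_def e_def step f_def[symmetric]
      by (simp add: diff_divide_distrib)
    then have EE': "E = f * E'"
      using f \<delta> by (simp add: E abs_minus_commute)
    have E'0: "E' \<ge> 0" by (simp add: E'_def e_def)
    have IH: "\<delta>\<^sup>2 / 2 \<le> E' \<or> \<delta> ^ 3 / 4 \<le> real_of_int q * E' - E'\<^sup>2 / \<delta>"
      using less.IH[of "nat q" "int m" "Suc k"] 3 unfolding E'_def by simp
    show ?thesis
    proof (cases "\<delta>\<^sup>2 / 2 \<le> E")
      case False
      show ?thesis
      proof (cases "\<delta>\<^sup>2 / 2 \<le> E'")
        case True
        \<comment> \<open>The form has just become small, so \<open>E\<close> lies between \<open>\<delta> \<cdot> \<delta>\<^sup>2 / 2\<close> and \<open>\<delta>\<^sup>2 / 2\<close>; this is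
          where the constant \<open>\<delta> ^ 3 / 4\<close> comes from.\<close>
        have "\<delta> * (\<delta>\<^sup>2 / 2) \<le> E"
          unfolding EE' using True f \<delta> by (intro mult_mono) auto
        moreover have "1 / 2 \<le> real m - E / \<delta>"
        proof -
          have "E / \<delta> \<le> (\<delta>\<^sup>2 / 2) / \<delta>" using False \<delta> by (intro divide_right_mono) auto
          also have "\<dots> \<le> 1 / 2" using \<delta> \<delta>1 by (simp add: power2_eq_square)
          finally show ?thesis using m1 by linarith
        qed
        ultimately have "(\<delta> * (\<delta>\<^sup>2 / 2)) * (1 / 2) \<le> E * (real m - E / \<delta>)"
          using \<delta> by (intro mult_mono) (auto simp: E)
        then show ?thesis by (simp add: power2_eq_square power3_eq_cube algebra_simps)
      next
        case False
        have "real_of_int q \<le> f * (real m + E')"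
          using E EE' by (simp add: algebra_simps)
        then have "real_of_int q * E' \<le> f * (real m + E') * E'"
          using E'0 by (rule mult_right_mono)
        then have q: "real_of_int q * E' \<le> real m * E + f * E'\<^sup>2"
          by (simp add: EE' algebra_simps power2_eq_square)
        \<comment> \<open>The inequality that makes the correction term pay for the error \<open>f * E'\<^sup>2\<close>.\<close>
        have "f * (f + \<delta>) \<le> 1 * 1"
          using f \<delta> by (intro mult_mono) auto
        then have "f * (f + \<delta>) * (E'\<^sup>2 / \<delta>) \<le> 1 * (E'\<^sup>2 / \<delta>)"
          using \<delta> by (intro mult_right_mono) auto
        then have "E\<^sup>2 / \<delta> + f * E'\<^sup>2 \<le> E'\<^sup>2 / \<delta>"
          using \<delta> by (simp add: EE' field_simps power2_eq_square)
        then show ?thesis using IH False q by linarith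
      qed
    qed simp
  qed
  then show ?case by (simp add: E_def)
qed

lemma complete_quotient_irrational:
  assumes "\<alpha> \<notin> \<rat>"
  shows "complete_quotient \<alpha> k \<notin> \<rat>"
proof (induction k)
  case (Suc k)
  have "x \<in> \<rat>" if "1 / frac x \<in> \<rat>" for x :: real
  proof -
    have "frac x \<in> \<rat>" using Rats_inverse[OF that] by simp
    then have "frac x + of_int \<lfloor>x\<rfloor> \<in> \<rat>" by (intro Rats_add) auto
    then show ?thesis by (simp add: frac_def)
  qed
  with Suc show ?case by (metis complete_quotient.simps(2))
qed (use assms in auto)

text \<open>
  If the coefficients are at most \<open>M\<close>, all complete quotients \<open>x\<^sub>k\<close> with \<open>k \<ge> 1\<close> are below \<open>M + 1\<close>,
  so fractional parts stay above \<open>1 / (M + 1)\<close>. Consequently \<open>x\<^sub>k\<close> also exceeds \<open>1\<close> by a fixed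
  amount, and fractional parts stay away from \<open>1\<close> as well. The descent then applies uniformly.
\<close>

lemma badly_approximable:
  assumes irr: "\<alpha> \<notin> \<rat>" and "bounded_cf_coeffs \<alpha>"
  obtains c :: real where "0 < c" "\<And>m p. m > 0 \<Longrightarrow> c / real m \<le> \<bar>real m * \<alpha> - of_int p\<bar>"
proof -
  obtain M0 where M0: "\<And>k. k \<ge> 1 \<Longrightarrow> cf_coeff \<alpha> k \<le> M0"
    using assms by (auto simp: bounded_cf_coeffs_def)
  define M where "M = real_of_int (max M0 1)"
  define x where "x = complete_quotient \<alpha>"
  define \<delta> where "\<delta> = 1 / (M + 2)"
  have M: "M \<ge> 1" by (simp add: M_def)
  then have \<delta>: "0 < \<delta>" by (simp add: \<delta>_def)
  have step: "x (Suc k) = 1 / frac (x k)" for k by (simp add: x_def)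
  have pos: "frac (x k) > 0" for k
    using complete_quotient_irrational[OF irr, of k] Ints_subset_Rats by (auto simp: x_def)
  have x1: "x (Suc k) > 1" for k
    using pos[of k] frac_lt_1[of "x k"] by (simp add: step)
  have inv: "frac (x k) = 1 / x (Suc k)" for k
    by (simp add: step)
  have up: "x (Suc k) < M + 1" for k
  proof -
    have "\<lfloor>x (Suc k)\<rfloor> \<le> M0" using M0[of "Suc k"] by (simp add: cf_coeff_def x_def)
    then have "real_of_int \<lfloor>x (Suc k)\<rfloor> \<le> M" by (auto simp: M_def)
    then show ?thesis by linarith
  qed
  have lo': "1 / (M + 1) \<le> frac (x k)" for k
    unfolding inv using up[of k] x1[of k] by (intro divide_left_mono) auto
  have lo: "\<delta> \<le> frac (x k)" for k
  proof -
    have "\<delta> \<le> 1 / (M + 1)" unfolding \<delta>_def using M by (intro divide_left_mono) auto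
    then show ?thesis using lo'[of k] by linarith
  qed
  have hi: "frac (x k) \<le> 1 - \<delta>" for k
  proof -
    have "1 \<le> \<lfloor>x (Suc k)\<rfloor>" using x1[of k] by linarith
    then have "1 + 1 / (M + 1) \<le> x (Suc k)"
      using lo'[of "Suc k"] unfolding frac_def by linarith
    moreover have "0 < 1 + 1 / (M + 1)" using M by (intro add_pos_pos) auto
    ultimately have "frac (x k) \<le> 1 / (1 + 1 / (M + 1))"
      unfolding inv using x1[of k] by (intro divide_left_mono mult_pos_pos) auto
    also have "\<dots> = 1 - \<delta>" using M by (simp add: \<delta>_def field_simps)
    finally show ?thesis .
  qed
  have \<delta>1: "\<delta> \<le> 1" using M by (simp add: \<delta>_def)
  show thesis
  proof (rule that)
    show "0 < \<delta> ^ 3 / 4" using \<delta> by simp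
    fix m :: nat and p :: int assume m: "m > 0"
    define e where "e = \<bar>real m * \<alpha> - of_int p\<bar>"
    have "\<delta>\<^sup>2 / 2 \<le> e \<or> \<delta> ^ 3 / 4 \<le> real m * e - e\<^sup>2 / \<delta>"
      using linear_form_descent[where x = x and m = m and p = p and k = 0, OF \<delta> lo hi step m] by (simp add: e_def x_def)
    then have "\<delta> ^ 3 / 4 \<le> real m * e"
    proof
      assume "\<delta>\<^sup>2 / 2 \<le> e"
      moreover have "\<delta> ^ 3 / 4 \<le> \<delta>\<^sup>2 / 2"
        using \<delta> \<delta>1 by (simp add: power2_eq_square power3_eq_cube mult_le_cancel_left)
      moreover have "e \<le> real m * e"
        using m by (simp add: e_def mult_le_cancel_right1)
      ultimately show ?thesis by linarith
    next
      assume "\<delta> ^ 3 / 4 \<le> real m * e - e\<^sup>2 / \<delta>"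
      moreover have "e\<^sup>2 / \<delta> \<ge> 0" using \<delta> by simp
      ultimately show ?thesis by linarith
    qed
    then show "\<delta> ^ 3 / 4 / real m \<le> \<bar>real m * \<alpha> - of_int p\<bar>"
      using m by (simp add: e_def divide_le_eq mult.commute)
  qed
qed

section \<open>Bounded remainder sets\<close>

lemma count_in_eq_sum: "real (count_in z N I) = (\<Sum>n=1..N. of_bool (z n \<in> I))"
  by (simp add: count_in_def of_bool_def sum.If_cases Int_def)

lemma bounded_remainder_setI:
  assumes "0 \<le> a" "a < b" "b \<le> 1"
    and "\<And>N. \<bar>(\<Sum>n=1..N. of_bool (z n \<in> {a..<b}) - (b - a))\<bar> \<le> C"
  shows "bounded_remainder_set z a b"
proof -
  have "\<bar>discrepancy z N a b\<bar> \<le> C * (1 / real N)" if "N \<ge> 1" for N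
  proof -
    have "real (count_in z N {a..<b}) - real N * (b - a)
        = (\<Sum>n=1..N. of_bool (z n \<in> {a..<b}) - (b - a))"
      by (simp add: count_in_eq_sum sum_subtractf)
    then show ?thesis
      using assms(4)[of N] that by (simp add: discrepancy_def abs_mult divide_right_mono)
  qed
  then show ?thesis using assms(1-3) by (auto simp: bounded_remainder_set_def)
qed

text \<open>A shift by one telescopes to two boundary values; a shift by \<open>j\<close> is \<open>j\<close> of these.\<close>

lemma sum_shift_diff_bounded:
  fixes g :: "int \<Rightarrow> real"
  assumes "\<And>k. 0 \<le> g k" "\<And>k. g k \<le> 1"
  shows "\<bar>\<Sum>n=1..N. g (int n) - g (int n - int j)\<bar> \<le> real j"
proof (induction j)
  case (Suc j)
  have "(\<Sum>n=1..N. g (int n - int j) - g (int n - int (Suc j)))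
      = g (int N - int j) - g (- int j)"
    by (induction N) (simp_all add: algebra_simps)
  moreover have "\<bar>g (int N - int j) - g (- int j)\<bar> \<le> 1"
    using assms(1)[of "int N - int j"] assms(1)[of "- int j"]
      assms(2)[of "int N - int j"] assms(2)[of "- int j"] by linarith
  moreover have "(\<Sum>n=1..N. g (int n) - g (int n - int (Suc j)))
      = (\<Sum>n=1..N. g (int n) - g (int n - int j))
        + (\<Sum>n=1..N. g (int n - int j) - g (int n - int (Suc j)))"
    by (simp flip: sum.distrib)
  ultimately show ?case using Suc by simp
qed simp

text \<open>
  This exhibits the centred indicator of \<open>[{u}, {v})\<close> as a difference of two translates of the
  bounded function \<open>frac\<close>. For \<open>u\<close> and \<open>v\<close> in the orbit of a rotation it is a coboundary, which
  is the easy half of Kesten's theorem on bounded remainder intervals.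
\<close>

lemma indicator_eq_frac_diff:
  fixes t u v :: real
  assumes "frac u < frac v"
  shows "of_bool (frac t \<in> {frac u..<frac v})
       = (frac v - frac u) + frac (t - v) - frac (t - u)"
proof -
  have "frac (t - w) = frac t - frac w + of_bool (frac t < frac w)" for w
    using frac_diff_pos[of w t] frac_diff_neg[of t w] by (cases "frac t < frac w") auto
  then show ?thesis using assms by auto
qed

text \<open>A shift shorter than the distance to the nearest integer crosses no integer.\<close>

lemma frac_add_small:
  fixes t s :: real
  assumes "\<And>p::int. \<bar>s\<bar> < \<bar>t - of_int p\<bar>"
  shows "frac (t + s) = frac t + s"
proof -
  have "\<bar>s\<bar> < \<bar>t - of_int \<lfloor>t\<rfloor>\<bar>" "\<bar>s\<bar> < \<bar>t - of_int (\<lfloor>t\<rfloor> + 1)\<bar>"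
    using assms by blast+
  then have "\<lfloor>t + s\<rfloor> = \<lfloor>t\<rfloor>" by linarith
  then show ?thesis by (simp add: frac_def)
qed

text \<open>
  The count splits into that of the unperturbed rotation, which telescopes, and the changes \<open>d n\<close>
  of the indicator caused by the shift \<open>s n\<close>. Once \<open>s n\<close> is smaller than the distances to the
  integers, the two fractional parts in \<open>indicator_eq_frac_diff\<close> both change by \<open>s n\<close>, so that
  \<open>d n = 0\<close>.
\<close>

lemma perturbed_rotation_BRS:
  fixes \<alpha> :: real and s :: "nat \<Rightarrow> real"
  assumes "\<And>w. w \<in> {i, j} \<Longrightarrow>
      eventually (\<lambda>n. \<forall>p::int. \<bar>s n\<bar> < \<bar>(real n - real w) * \<alpha> - of_int p\<bar>) sequentially"
    and less: "frac (real i * \<alpha>) < frac (real j * \<alpha>)"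
  shows "bounded_remainder_set (\<lambda>n. frac (real n * \<alpha> + s n)) (frac (real i * \<alpha>)) (frac (real j * \<alpha>))"
proof -
  define u v where "u = frac (real i * \<alpha>)" and "v = frac (real j * \<alpha>)"
  define I where "I = {u..<v}"
  define g where "g = (\<lambda>k::int. frac (real_of_int k * \<alpha>))"
  define h where "h = (\<lambda>n. of_bool (frac (real n * \<alpha>) \<in> I) - (v - u))"
  define d where "d = (\<lambda>n. of_bool (frac (real n * \<alpha> + s n) \<in> I)
                          - of_bool (frac (real n * \<alpha>) \<in> I) :: real)"
  have "eventually (\<lambda>n. d n = 0) sequentially"
    using assms(1)[of i, simplified] assms(1)[of j, simplified]
  proof eventually_elim
    case (elim n)
    have *: "frac (real n * \<alpha> + s n - real w * \<alpha>) = frac (real n * \<alpha> - real w * \<alpha>) + s n"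
      if "w \<in> {i, j}" for w
      using frac_add_small[of "s n" "(real n - real w) * \<alpha>"] elim that
      by (auto simp: algebra_simps)
    show ?case
      unfolding d_def I_def u_def v_def indicator_eq_frac_diff[OF less] using * by simp
  qed
  then obtain K where K: "\<And>n. n \<ge> K \<Longrightarrow> d n = 0"
    by (auto simp: eventually_sequentially)
  have d: "\<bar>\<Sum>n=1..N. d n\<bar> \<le> real K" for N
  proof -
    have "(\<Sum>n=1..N. \<bar>d n\<bar>) \<le> (\<Sum>n=1..N. of_bool (n < K))"
      using K by (intro sum_mono) (auto simp: d_def not_less)
    also have "\<dots> = (\<Sum>n\<in>{1..N} \<inter> {..<K}. 1)"
      by (simp add: of_bool_def sum.If_cases Int_def)
    also have "\<dots> \<le> (\<Sum>n\<in>{..<K}. 1)"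
      by (intro sum_mono2) auto
    finally show ?thesis
      by (intro order_trans[OF sum_abs]) simp
  qed
  have h: "\<bar>\<Sum>n=1..N. h n\<bar> \<le> real i + real j" for N
  proof -
    have "h n = (g (int n) - g (int n - int i)) - (g (int n) - g (int n - int j))" for n
      unfolding h_def I_def u_def v_def indicator_eq_frac_diff[OF less]
      by (simp add: g_def algebra_simps)
    then have "(\<Sum>n=1..N. h n) = (\<Sum>n=1..N. g (int n) - g (int n - int i))
                               - (\<Sum>n=1..N. g (int n) - g (int n - int j))"
      by (simp add: sum_subtractf)
    moreover have shift: "\<bar>\<Sum>n=1..N. g (int n) - g (int n - int k)\<bar> \<le> real k" for k
      by (rule sum_shift_diff_bounded) (auto simp: g_def frac_lt_1 less_imp_le)
    ultimately show ?thesis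
      using shift[of i] shift[of j] by linarith
  qed
  have "\<bar>\<Sum>n=1..N. of_bool (frac (real n * \<alpha> + s n) \<in> I) - (v - u)\<bar> \<le> real i + real j + real K" for N
  proof -
    have "(\<Sum>n=1..N. of_bool (frac (real n * \<alpha> + s n) \<in> I) - (v - u))
        = (\<Sum>n=1..N. h n) + (\<Sum>n=1..N. d n)"
      by (simp add: h_def d_def algebra_simps flip: sum.distrib)
    then show ?thesis using h[of N] d[of N] by linarith
  qed
  then show ?thesis
    using less unfolding I_def u_def v_def
    by (intro bounded_remainder_setI) (auto simp: frac_lt_1 less_imp_le)
qed

lemma dense_BRS_if_orbit_intervals:
  assumes irr: "\<alpha> \<notin> \<rat>"
    and brs: "\<And>i j. frac (real i * \<alpha>) < frac (real j * \<alpha>) \<Longrightarrow>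
            bounded_remainder_set z (frac (real i * \<alpha>)) (frac (real j * \<alpha>))"
  shows "dense_BRS z"
  unfolding dense_BRS_def
proof (intro allI impI ballI)
  fix \<epsilon> x y :: real
  assume \<epsilon>: "\<epsilon> > 0" and x: "x \<in> {0..<1}" and y: "y \<in> {0..<1}" and xy: "x < y"
  \<comment> \<open>The second bound keeps the two endpoints in order.\<close>
  define \<eta> where "\<eta> = min \<epsilon> ((y - x) / 2)"
  have \<eta>: "\<eta> > 0" using \<epsilon> xy by (simp add: \<eta>_def)
  obtain i where i: "\<bar>frac (real i * \<alpha>) - x\<bar> < \<eta>"
    using Kronecker_approx_1_explicit[OF irr _ _ \<eta>, of x] x by auto
  obtain j where j: "\<bar>frac (real j * \<alpha>) - y\<bar> < \<eta>"
    using Kronecker_approx_1_explicit[OF irr _ _ \<eta>, of y] y by auto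
  have "\<eta> \<le> (y - x) / 2" "\<eta> \<le> \<epsilon>" unfolding \<eta>_def by (rule min.cobounded2, rule min.cobounded1)
  then show "\<exists>a b. bounded_remainder_set z a b \<and> \<bar>a - x\<bar> < \<epsilon> \<and> \<bar>b - y\<bar> < \<epsilon>"
    using i j by (intro exI[of _ "frac (real i * \<alpha>)"] exI[of _ "frac (real j * \<alpha>)"] conjI brs)
      (auto simp: field_simps abs_less_iff)
qed

section \<open>A dense collection of bounded remainder sets forces uniform distribution\<close>

lemma bounded_remainder_set_frequency:
  assumes "bounded_remainder_set z a b"
  shows "(\<lambda>N. real (count_in z N {a..<b}) / real N) \<longlonglongrightarrow> b - a"
proof -
  obtain c where c: "\<And>N. N \<ge> 1 \<Longrightarrow> \<bar>discrepancy z N a b\<bar> \<le> c * (1 / real N)"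
    using assms by (auto simp: bounded_remainder_set_def)
  have "(\<lambda>N. discrepancy z N a b) \<longlonglongrightarrow> 0"
  proof (rule Lim_null_comparison)
    show "eventually (\<lambda>N. norm (discrepancy z N a b) \<le> c * (1 / real N)) sequentially"
      using c by (auto simp: eventually_sequentially)
    show "(\<lambda>N. c * (1 / real N)) \<longlonglongrightarrow> 0"
      using tendsto_mult[OF tendsto_const lim_1_over_n, of c] by simp
  qed
  then have "(\<lambda>N. discrepancy z N a b + (b - a)) \<longlonglongrightarrow> 0 + (b - a)"
    by (intro tendsto_intros)
  moreover have "eventually (\<lambda>N. discrepancy z N a b + (b - a)
      = real (count_in z N {a..<b}) / real N) sequentially"
    using eventually_gt_at_top[of "0::nat"]
    by eventually_elim (simp add: discrepancy_def field_simps)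
  ultimately show ?thesis by (simp add: tendsto_cong)
qed

lemma count_in_mono: "I \<subseteq> J \<Longrightarrow> count_in z N I \<le> count_in z N J"
  unfolding count_in_def by (intro card_mono) auto

text \<open>
  If \<open>b - a > \<epsilon>\<close>, some bounded remainder set lies inside \<open>[a, b)\<close> and is shorter by less than \<open>\<epsilon>\<close>.
\<close>

lemma dense_BRS_frequency_lower:
  assumes "dense_BRS z" "0 \<le> a" "a \<le> b" "b \<le> 1" "\<epsilon> > 0"
  shows "eventually (\<lambda>N. b - a - \<epsilon> \<le> real (count_in z N {a..<b}) / real N) sequentially"
proof (cases "\<epsilon> < b - a")
  case False
  then have "b - a - \<epsilon> \<le> real (count_in z N {a..<b}) / real N" for N
    using divide_nonneg_nonneg[of "real (count_in z N {a..<b})" "real N"] by linarith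
  then show ?thesis by simp
next
  case True
  obtain a' b' where ab: "bounded_remainder_set z a' b'"
      "\<bar>a' - (a + \<epsilon> / 4)\<bar> < \<epsilon> / 4" "\<bar>b' - (b - \<epsilon> / 4)\<bar> < \<epsilon> / 4"
    using assms True unfolding dense_BRS_def
    by (elim allE[of _ "\<epsilon> / 4"] impE ballE[of _ _ "a + \<epsilon> / 4"] ballE[of _ _ "b - \<epsilon> / 4"]) auto
  have "b - a - \<epsilon> < b' - a'" using ab by linarith
  then have "eventually (\<lambda>N. b - a - \<epsilon> < real (count_in z N {a'..<b'}) / real N) sequentially"
    by (rule order_tendstoD(1)[OF bounded_remainder_set_frequency[OF ab(1)]])
  then show ?thesis
  proof eventually_elim
    case (elim N)
    have "a \<le> a'" "b' \<le> b" using ab by linarith+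
    then have "{a'..<b'} \<subseteq> {a..<b}" by auto
    then have "real (count_in z N {a'..<b'}) / real N \<le> real (count_in z N {a..<b}) / real N"
      by (intro divide_right_mono) (auto intro: count_in_mono)
    then show ?case using elim by linarith
  qed
qed

text \<open>
  The frequencies of \<open>[0, a)\<close>, \<open>[a, b)\<close> and \<open>[b, 1)\<close> add up to \<open>1\<close>, so lower bounds for the outer
  two intervals give the upper bound for the middle one.
\<close>

lemma dense_BRS_imp_uniformly_distributed:
  assumes z: "\<And>n. z n \<in> {0..<1}" and dense: "dense_BRS z"
  shows "uniformly_distributed_mod1 z"
  unfolding uniformly_distributed_mod1_def
proof (intro allI impI order_tendstoI)
  fix a b :: real
  assume ab: "0 \<le> a \<and> a < b \<and> b \<le> 1"
  define F where "F = (\<lambda>a b N. real (count_in z N {a..<b}) / real N)"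
  have low: "eventually (\<lambda>N. d - c - \<epsilon> \<le> F c d N) sequentially"
    if "0 \<le> c" "c \<le> d" "d \<le> 1" "\<epsilon> > 0" for c d \<epsilon>
    unfolding F_def using dense_BRS_frequency_lower[OF dense that] .
  show "eventually (\<lambda>N. t < real (count_in z N {a..<b}) / real N) sequentially" if "t < b - a" for t
    using low[of a b "(b - a - t) / 2"] ab that unfolding F_def
    by (auto elim!: eventually_mono simp: field_simps)
  show "eventually (\<lambda>N. real (count_in z N {a..<b}) / real N < t) sequentially" if "b - a < t" for t
  proof -
    define \<epsilon> where "\<epsilon> = (t - (b - a)) / 3"
    have \<epsilon>: "\<epsilon> > 0" using that by (simp add: \<epsilon>_def)
    have "eventually (\<lambda>N. a - 0 - \<epsilon> \<le> F 0 a N) sequentially"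
         "eventually (\<lambda>N. 1 - b - \<epsilon> \<le> F b 1 N) sequentially"
      using low[of 0 a \<epsilon>] low[of b 1 \<epsilon>] ab \<epsilon> by simp_all
    then have "eventually (\<lambda>N. F a b N < t) sequentially"
      using eventually_gt_at_top[of "0::nat"]
    proof eventually_elim
      case (elim N)
      have "real (count_in z N {0..<a}) + real (count_in z N {a..<b}) + real (count_in z N {b..<1})
          = (\<Sum>n=1..N. of_bool (z n \<in> {0..<a}) + of_bool (z n \<in> {a..<b}) + of_bool (z n \<in> {b..<1}))"
        by (simp add: count_in_eq_sum sum.distrib)
      also have "\<dots> = (\<Sum>n=1..N. 1)"
        using z ab by (intro sum.cong) (auto simp: not_less)
      finally have "F 0 a N + F a b N + F b 1 N = 1"
        using elim by (simp add: F_def flip: add_divide_distrib)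
      moreover have "t = b - a + 3 * \<epsilon>" by (simp add: \<epsilon>_def field_simps)
      ultimately show ?case using elim \<epsilon> by linarith
    qed
    then show ?thesis by (simp add: F_def)
  qed
qed

section \<open>Construction of the sequence\<close>

theorem theorem5:
  fixes \<phi> :: "nat \<Rightarrow> real"
  assumes "strict_mono_on {1..} \<phi>"
    and "\<And>n. n \<ge> 1 \<Longrightarrow> \<phi> n \<ge> 2 * real n"
  shows "\<forall>\<alpha>::real. \<alpha> \<notin> \<rat> \<and> bounded_cf_coeffs \<alpha> \<longrightarrow>
           (\<exists>(L::real) (a::nat \<Rightarrow> int).
              strict_mono_on {1..} a \<and>
              (\<forall>n\<ge>1. \<phi> n \<le> real_of_int (a n) \<and> real_of_int (a n) \<le> L * \<phi> n) \<and>
              uniformly_distributed_mod1 (\<lambda>n. frac (real_of_int (a n) * \<alpha>)) \<and>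
              dense_BRS (\<lambda>n. frac (real_of_int (a n) * \<alpha>)))"
proof (intro allI impI, elim conjE)
  fix \<alpha> :: real
  assume irr: "\<alpha> \<notin> \<rat>" and bdd: "bounded_cf_coeffs \<alpha>"
  obtain c where c: "0 < c" and bad: "\<And>m p. m > 0 \<Longrightarrow> c / real m \<le> \<bar>real m * \<alpha> - of_int p\<bar>"
    using badly_approximable[OF irr bdd] by metis
  define good where "good = (\<lambda>n (m::nat). \<phi> n \<le> real m \<and> (\<exists>p::int. \<bar>real m * \<alpha> - of_int p\<bar> < c / \<phi> n))"
  define m where "m = (\<lambda>n. LEAST k. good n k)"
  define a where "a = (\<lambda>n. int (n + m n))"
  have ex: "\<exists>k. good n k \<and> real k \<le> \<phi> n / c + 1" if n: "n \<ge> 1" for n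
  proof -
    have \<phi>: "\<phi> n > 0" using assms(2)[OF n] n by linarith
    define N where "N = nat \<lceil>\<phi> n / c\<rceil>"
    have "\<phi> n / c > 0" using \<phi> c by simp
    then have N: "\<phi> n / c \<le> real N" "real N \<le> \<phi> n / c + 1" "N > 0"
      unfolding N_def by linarith+
    obtain h k where hk: "0 < k" "k \<le> int N" "\<bar>of_int k * \<alpha> - of_int h\<bar> < 1 / real N"
      using Dirichlet_approx[OF N(3)] by blast
    have "1 / real N \<le> 1 / (\<phi> n / c)" using N \<phi> c by (intro divide_left_mono) auto
    then have close: "\<bar>real (nat k) * \<alpha> - of_int h\<bar> < c / \<phi> n" using hk by simp
    \<comment> \<open>Bad approximability turns the smallness of the distance into a lower bound on \<open>k\<close>.\<close>
    with bad[of "nat k" h] hk have "c / real (nat k) < c / \<phi> n" by simp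
    then have "\<phi> n < real (nat k)"
      using c \<phi> hk by (simp add: divide_simps mult_less_cancel_left)
    then show ?thesis
      using close N hk by (intro exI[of _ "nat k"]) (auto simp: good_def)
  qed
  have good: "good n (m n)" if "n \<ge> 1" for n
    unfolding m_def using ex[OF that] by (blast intro: LeastI)
  have m_le: "m n \<le> k" if "good n k" for n k
    unfolding m_def using that by (rule Least_le)
  have mono: "m n \<le> m n'" if "1 \<le> n" "n < n'" for n n'
  proof (rule m_le)
    have "\<phi> n < \<phi> n'" using strict_mono_onD[OF assms(1)] that by simp
    moreover have "\<phi> n > 0" using assms(2)[of n] that by linarith
    ultimately have "c / \<phi> n' \<le> c / \<phi> n" using c by (intro divide_left_mono) auto
    with \<open>\<phi> n < \<phi> n'\<close> good[of n'] that show "good n (m n')"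
      unfolding good_def by (meson dual_order.trans le_cases less_imp_le less_le_trans order_less_le_trans)
  qed
  have sm: "strict_mono_on {1..} a"
    using mono by (force intro!: strict_mono_onI simp: a_def)
  have bounds: "\<phi> n \<le> real_of_int (a n) \<and> real_of_int (a n) \<le> (1 + 1 / c) * \<phi> n" if n: "n \<ge> 1" for n
  proof -
    obtain k where "good n k" "real k \<le> \<phi> n / c + 1" using ex[OF n] by blast
    then have "real (m n) \<le> \<phi> n / c + 1" using m_le[of n k] by linarith
    moreover have "1 + real n \<le> \<phi> n" using assms(2)[OF n] n by linarith
    ultimately show ?thesis using good[OF n] by (auto simp: a_def good_def algebra_simps)
  qed
  have "\<forall>n. \<exists>p::int. n \<ge> 1 \<longrightarrow> \<bar>real (m n) * \<alpha> - of_int p\<bar> < c / \<phi> n"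
    using good by (auto simp: good_def)
  then obtain p :: "nat \<Rightarrow> int" where p: "\<And>n. n \<ge> 1 \<Longrightarrow> \<bar>real (m n) * \<alpha> - of_int (p n)\<bar> < c / \<phi> n"
    by metis
  define s where "s = (\<lambda>n. real (m n) * \<alpha> - of_int (p n))"
  have orbit: "frac (real_of_int (a n) * \<alpha>) = frac (real n * \<alpha> + s n)" for n
  proof -
    have "real_of_int (a n) * \<alpha> = (real n * \<alpha> + s n) + of_int (p n)"
      by (simp add: a_def s_def algebra_simps)
    then show ?thesis by (metis frac_add_of_int_right)
  qed
  have far: "eventually (\<lambda>n. \<forall>q::int. \<bar>s n\<bar> < \<bar>(real n - real w) * \<alpha> - of_int q\<bar>) sequentially" for w
    using eventually_gt_at_top[of w]
  proof eventually_elim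
    case (elim n)
    have n: "n \<ge> 1" using elim by simp
    have "\<bar>s n\<bar> < c / \<phi> n" using p[OF n] by (simp add: s_def)
    also have "\<dots> \<le> c / real (n - w)"
      using elim c assms(2)[OF n] by (intro divide_left_mono) (auto simp: of_nat_diff)
    finally show ?case
      using bad[of "n - w"] elim by (auto simp: of_nat_diff intro: less_le_trans)
  qed
  have dense: "dense_BRS (\<lambda>n. frac (real_of_int (a n) * \<alpha>))"
    unfolding orbit using far
    by (intro dense_BRS_if_orbit_intervals[OF irr] perturbed_rotation_BRS)
  moreover have "uniformly_distributed_mod1 (\<lambda>n. frac (real_of_int (a n) * \<alpha>))"
    using dense by (intro dense_BRS_imp_uniformly_distributed) (auto simp: frac_lt_1)
  ultimately show "\<exists>L a. strict_mono_on {1..} a \<and>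
      (\<forall>n\<ge>1. \<phi> n \<le> real_of_int (a n) \<and> real_of_int (a n) \<le> L * \<phi> n) \<and>
      uniformly_distributed_mod1 (\<lambda>n. frac (real_of_int (a n) * \<alpha>)) \<and>
      dense_BRS (\<lambda>n. frac (real_of_int (a n) * \<alpha>))"
    using sm bounds by blast
qed

end
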